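(* Let $\mathscr{B}\subseteq\mathbb{N}\setminus\{1\}$ be spiky and infinite. Then $\mathbb{A}_{\mathscr{B}}$ admits only trivial automorphisms, i.e. $\mathrm{Aut}(\mathbb{A}_{\mathscr{B}})=\{\sigma^n:n\in\mathbb{Z}\}$.
   Context: A set $\mathscr{B}\subseteq\mathbb{N}\setminus\{1\}$ is spiky if for every finite subset $S\subseteq\mathscr{B}$ and every $b\in\mathscr{B}$, $b\mid\operatorname{lcm}(S)$ implies $b\in S$. $\sigma$ is the left shift on $\{0,1\}^{\mathbb{Z}}$, $(\sigma x)[n]=x[n+1]$. For a subshift (closed $\sigma$-invariant subset) $X\subseteq\{0,1\}^{\mathbb{Z}}$, $\mathrm{Aut}(X)$ is the group of all homeomorphisms $X\to X$ commuting with $\sigma$. A set $A\subset\mathbb{Z}$ is $\mathscr{B}$-admissible if for every $b\in\mathscr{B}$ one has $|A \bmod b|<b$; $\mathbb{A}_{\mathscr{B}}$ is the subshift of all $x\in\{0,1\}^{\mathbb{Z}}$ whose support $\{n\in\mathbb{Z}:x[n]\neq0\}$ is $\mathscr{B}$-admissible. *)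

theory Defs
  imports "HOL-Analysis.Analysis"
begin

text \<open>
  Here \<open>\<nat>\<close> is the set of positive integers, so \<open>\<nat> \<setminus> {1}\<close> is \<open>{2..}\<close>.
  For a finite set, \<^const>\<open>Lcm\<close> is the least common multiple of its elements
  (and \<open>1\<close> for the empty set).
\<close>

definition spiky :: "nat set \<Rightarrow> bool" where
  "spiky B \<longleftrightarrow> B \<subseteq> {2..} \<and>
     (\<forall>S b. finite S \<and> S \<subseteq> B \<and> b \<in> B \<and> b dvd Lcm S \<longrightarrow> b \<in> S)"

text \<open>
  The symbols \<open>1\<close> and \<open>0\<close> are \<^const>\<open>True\<close> and \<^const>\<open>False\<close>. The library topology on
  \<^typ>\<open>int \<Rightarrow> bool\<close> is the product of the order topologies on \<^typ>\<open>bool\<close>, which are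
  discrete, i.e. it is the usual topology of the full two-sided shift.
\<close>

definition left_shift :: "(int \<Rightarrow> bool) \<Rightarrow> (int \<Rightarrow> bool)" where
  "left_shift x = (\<lambda>n. x (n + 1))"

definition left_shift_power :: "int \<Rightarrow> (int \<Rightarrow> bool) \<Rightarrow> (int \<Rightarrow> bool)" where
  "left_shift_power k =
     (if 0 \<le> k then left_shift ^^ nat k else inv left_shift ^^ nat (- k))"

definition subshift :: "(int \<Rightarrow> bool) set \<Rightarrow> bool" where
  "subshift X \<longleftrightarrow> closed X \<and> left_shift ` X = X"

text \<open>
  Self-maps of \<open>X\<close> are represented by functions that are \<^const>\<open>undefined\<close> off \<open>X\<close>, so that
  two of them are equal iff they agree on \<open>X\<close>. The group law is composition on \<open>X\<close>.
\<close>

definition Aut :: "(int \<Rightarrow> bool) set \<Rightarrow> ((int \<Rightarrow> bool) \<Rightarrow> (int \<Rightarrow> bool)) set" where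
  "Aut X = {f \<in> extensional X.
     (\<exists>g. homeomorphism X X f g) \<and> (\<forall>x\<in>X. f (left_shift x) = left_shift (f x))}"

definition admissible :: "nat set \<Rightarrow> int set \<Rightarrow> bool" where
  "admissible B A \<longleftrightarrow> (\<forall>b\<in>B. card ((\<lambda>a. a mod int b) ` A) < b)"

definition admissible_subshift :: "nat set \<Rightarrow> (int \<Rightarrow> bool) set" where
  "admissible_subshift B = {x. admissible B {n. x n}}"

lemma left_shift_funpow: "(left_shift ^^ m) x = (\<lambda>n. x (n + int m))"
  by (induction m) (auto simp: left_shift_def algebra_simps)

lemma inv_left_shift: "inv left_shift x = (\<lambda>n. x (n - 1))"
proof -
  have "left_shift y = left_shift z \<Longrightarrow> y = z" for y z
    unfolding left_shift_def by (rule ext) (metis diff_add_cancel)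
  moreover have "left_shift (\<lambda>n. x (n - 1)) = x"
    by (simp add: left_shift_def)
  ultimately show ?thesis
    by (metis inv_f_f injI)
qed

lemma left_shift_power_apply: "left_shift_power k x n = x (n + k)"
proof -
  have "(inv left_shift ^^ m) x = (\<lambda>n. x (n - int m))" for m
    by (induction m) (auto simp: inv_left_shift algebra_simps)
  then show ?thesis
    by (simp add: left_shift_power_def left_shift_funpow)
qed

lemma admissible_iff_missed_class:
  assumes "B \<subseteq> {2..}"
  shows "admissible B A \<longleftrightarrow> (\<forall>b\<in>B. \<exists>r\<in>{0..<int b}. \<forall>a\<in>A. a mod int b \<noteq> r)"
proof -
  have "card ((\<lambda>a. a mod int b) ` A) < b \<longleftrightarrow> (\<exists>r\<in>{0..<int b}. \<forall>a\<in>A. a mod int b \<noteq> r)"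
    if "b \<in> B" for b
  proof -
    let ?R = "(\<lambda>a. a mod int b) ` A"
    have sub: "?R \<subseteq> {0..<int b}"
      using assms that by force
    then have "card ?R < b \<longleftrightarrow> ?R \<noteq> {0..<int b}"
      using psubset_card_mono[of "{0..<int b}" ?R] by auto
    also have "\<dots> \<longleftrightarrow> (\<exists>r\<in>{0..<int b}. r \<notin> ?R)"
      using sub by blast
    also have "\<dots> \<longleftrightarrow> (\<exists>r\<in>{0..<int b}. \<forall>a\<in>A. a mod int b \<noteq> r)"
      by (intro bex_cong refl) auto
    finally show ?thesis .
  qed
  then show ?thesis
    by (simp add: admissible_def)
qed

lemma subshift_admissible_subshift:
  assumes "B \<subseteq> {2..}"
  shows "subshift (admissible_subshift B)"
proof -
  have eq: "admissible_subshift B =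
      (\<Inter>b\<in>B. \<Union>r\<in>{0..<int b}. \<Inter>n\<in>{n. n mod int b = r}. {x. x n = False})"
    unfolding admissible_subshift_def admissible_iff_missed_class[OF assms] set_eq_iff
      INT_iff UN_iff mem_Collect_eq by blast
  have "closed {x :: int \<Rightarrow> bool. x n = False}" for n
    by (intro closed_Collect_eq continuous_on_product_coordinates continuous_on_const)
  then have "closed (admissible_subshift B)"
    unfolding eq by (intro closed_INT closed_UN ballI) auto
  moreover have shift: "(\<lambda>n. x (n + k)) \<in> admissible_subshift B"
    if x: "x \<in> admissible_subshift B" for x k
    unfolding admissible_subshift_def admissible_iff_missed_class[OF assms] mem_Collect_eq
  proof
    fix b assume b: "b \<in> B"
    then obtain r where r: "\<forall>a. x a \<longrightarrow> a mod int b \<noteq> r" "r \<in> {0..<int b}"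
      using x unfolding admissible_subshift_def admissible_iff_missed_class[OF assms] by blast
    have "a mod int b \<noteq> (r - k) mod int b" if "x (a + k)" for a
    proof
      assume "a mod int b = (r - k) mod int b"
      then have "(a + k) mod int b = r mod int b"
        using mod_add_cong[of a "int b" "r - k" k k] by simp
      then show False
        using r that by auto
    qed
    moreover have "(r - k) mod int b \<in> {0..<int b}"
      using r(2) by auto
    ultimately show "\<exists>r\<in>{0..<int b}. \<forall>a\<in>{n. x (n + k)}. a mod int b \<noteq> r"
      by blast
  qed
  have "left_shift ` admissible_subshift B = admissible_subshift B"
  proof (intro equalityI subsetI)
    fix x assume "x \<in> admissible_subshift B"
    then have "x = left_shift (\<lambda>n. x (n + - 1))" "(\<lambda>n. x (n + - 1)) \<in> admissible_subshift B"
      using shift[of x "- 1"] by (simp_all add: left_shift_def)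
    then show "x \<in> left_shift ` admissible_subshift B"
      by (rule image_eqI)
  qed (auto simp: left_shift_def intro: shift)
  ultimately show ?thesis
    by (simp add: subshift_def)
qed

end

theory Submission
  imports Defs "HOL-Number_Theory.Cong"
begin

text \<open>
  Write \<open>e\<close> for the point whose support is \<open>{0}\<close>. An automorphism \<open>f\<close> fixes the zero point, so
  \<open>f e\<close> is not the zero point, and after composing \<open>f\<close> with a power of the shift its support
  contains \<open>0\<close>. The heart of the proof is that a continuous shift-commuting self-map \<open>f\<close> of the
  admissible subshift with this property never enlarges a support (\<open>equivariant_image_le\<close>).
  For then \<open>f e = e\<close>, so the inverse of \<open>f\<close> has the same property, and from \<open>f x \<le> x\<close> and
  \<open>inv f x \<le> x\<close> for all \<open>x\<close> it follows that \<open>f\<close> is the identity.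

  Suppose that \<open>0\<close> is in the support of \<open>f x\<close> but not in that of \<open>x\<close>. By continuity this
  depends only on a finite window \<open>A\<close> of the support of \<open>x\<close>. As \<open>B\<close> is infinite, it has an element
  \<open>b\<close> so large that \<open>A\<close> misses the class \<open>0\<close> modulo \<open>b\<close>. Add to \<open>A\<close> one point of every
  nonzero class modulo \<open>b\<close>, far from \<open>A\<close> and from each other. Seen from an added point, the
  new point \<open>y\<close> looks like \<open>e\<close>, so \<open>f y\<close> contains all the added points; it also contains \<open>0\<close>,
  because \<open>y\<close> agrees with \<open>x\<close> near \<open>0\<close>. Hence the support of \<open>f y\<close> meets every class modulo
  \<open>b\<close>, which is absurd provided \<open>y\<close> is admissible. Modulo \<open>b\<close> the support of \<open>y\<close> misses \<open>0\<close>,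
  and only the finitely many elements of \<open>B\<close> that do not exceed its cardinality can cause
  further trouble. For these, spikiness allows the added points to be chosen outside a class that
  \<open>x\<close> itself misses (\<open>spiky_avoid_classes\<close>); it takes the place of the Chinese remainder
  theorem for coprime moduli.
\<close>

section \<open>Powers of the shift\<close>

lemma left_shift_power_0: "left_shift_power 0 x = x"
  by (rule ext) (simp add: left_shift_power_apply)

lemma left_shift_power_add:
  "left_shift_power j (left_shift_power k x) = left_shift_power (j + k) x"
  by (rule ext) (simp add: left_shift_power_apply algebra_simps)

lemma left_shift_power_1: "left_shift_power 1 = left_shift"
  by (intro ext) (simp add: left_shift_power_apply left_shift_def)

lemma left_shift_power_commute:
  "left_shift_power k (left_shift x) = left_shift (left_shift_power k x)"
  by (rule ext) (simp add: left_shift_power_apply left_shift_def algebra_simps)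

lemma continuous_on_left_shift_power: "continuous_on A (left_shift_power k)"
  by (rule continuous_on_coordinatewise_then_product)
    (simp add: left_shift_power_apply
      continuous_on_subset[OF continuous_on_product_coordinates])

lemma left_shift_power_mem:
  assumes "subshift X" "x \<in> X"
  shows "left_shift_power k x \<in> X"
proof (induction k rule: int_induct[where k = 0])
  case base
  then show ?case by (simp add: assms left_shift_power_0)
next
  case (step1 k)
  have "left_shift (left_shift_power k x) \<in> X"
    using step1 assms(1) by (auto simp: subshift_def)
  then show ?case
    by (simp add: left_shift_power_add add.commute flip: left_shift_power_1)
next
  case (step2 k)
  obtain y where y: "y \<in> X" "left_shift_power k x = left_shift y"
    using step2 assms(1) by (auto simp: subshift_def)
  have "left_shift_power (k - 1) x = left_shift_power (- 1) (left_shift_power k x)"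
    by (simp add: left_shift_power_add)
  also have "\<dots> = y"
    by (simp add: y left_shift_power_add left_shift_power_0 flip: left_shift_power_1)
  finally show ?case using y by simp
qed

lemma commutes_left_shift_power:
  assumes "subshift X"
    and commute: "\<And>x. x \<in> X \<Longrightarrow> f (left_shift x) = left_shift (f x)"
    and "x \<in> X"
  shows "f (left_shift_power k x) = left_shift_power k (f x)"
proof (induction k rule: int_induct[where k = 0])
  case base
  then show ?case by (simp add: left_shift_power_0)
next
  case (step1 k)
  have "f (left_shift_power 1 (left_shift_power k x)) =
      left_shift_power 1 (f (left_shift_power k x))"
    using commute[OF left_shift_power_mem[OF assms(1,3)]] by (simp add: left_shift_power_1)
  then show ?case
    by (simp add: step1 left_shift_power_add add.commute)
next
  case (step2 k)
  have "left_shift_power 1 (f (left_shift_power (k - 1) x)) =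
      f (left_shift_power 1 (left_shift_power (k - 1) x))"
    using commute[OF left_shift_power_mem[OF assms(1,3)]] by (simp add: left_shift_power_1)
  also have "\<dots> = left_shift_power k (f x)"
    by (simp add: step2 left_shift_power_add)
  finally have "left_shift_power (- 1) (left_shift_power 1 (f (left_shift_power (k - 1) x))) =
      left_shift_power (- 1) (left_shift_power k (f x))"
    by simp
  then show ?case
    by (simp add: left_shift_power_add left_shift_power_0)
qed

lemma restrict_left_shift_power_in_Aut:
  assumes "subshift X"
  shows "restrict (left_shift_power k) X \<in> Aut X"
proof -
  have "homeomorphism X X (left_shift_power k) (left_shift_power (- k))"
    using left_shift_power_mem[OF assms]
    by (intro homeomorphismI)
      (auto simp: continuous_on_left_shift_power left_shift_power_add left_shift_power_0)
  then have "homeomorphism X X (restrict (left_shift_power k) X) (left_shift_power (- k))"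
    by (rule homeomorphism_cong) auto
  moreover have "left_shift x \<in> X" if "x \<in> X" for x
    using assms that by (auto simp: subshift_def)
  ultimately show ?thesis
    by (auto simp: Aut_def left_shift_power_commute)
qed

section \<open>Continuity in terms of finite windows\<close>

text \<open>
  The sets of points with prescribed values on a finite set of coordinates form a base of the
  product topology, and a single coordinate of \<open>f\<close> takes values in a discrete space, hence is
  locally constant. The radius \<open>M\<close> may depend on \<open>x\<close>.
\<close>

lemma continuous_on_window:
  fixes f :: "(int \<Rightarrow> bool) \<Rightarrow> int \<Rightarrow> bool"
  assumes "continuous_on X f" "x \<in> X"
  obtains M where "M \<ge> 0"
    and "\<And>y. y \<in> X \<Longrightarrow> (\<And>n. \<bar>n\<bar> \<le> M \<Longrightarrow> y n = x n) \<Longrightarrow> f y i = f x i"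
proof -
  have "open {z :: int \<Rightarrow> bool. z i = f x i}"
  proof -
    have "open ((\<lambda>z :: int \<Rightarrow> bool. z i) -` {f x i})"
      by (intro open_vimage continuous_on_product_coordinates open_discrete)
    then show ?thesis by (simp add: vimage_def)
  qed
  then obtain U where U: "open U" "U \<inter> X = f -` {z. z i = f x i} \<inter> X"
    using assms(1) unfolding continuous_on_open_invariant by blast
  with assms(2) have "x \<in> U" by blast
  then obtain V where V: "x \<in> Pi\<^sub>E UNIV V" "finite {n. V n \<noteq> UNIV}" "Pi\<^sub>E UNIV V \<subseteq> U"
    using product_topology_open_contains_basis[of "\<lambda>_. euclidean" UNIV U x] U(1)
    unfolding open_fun_def by (auto simp: topspace_euclidean)
  define M where "M = Max (insert 0 (abs ` {n. V n \<noteq> UNIV}))"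
  have M: "\<bar>n\<bar> \<le> M" if "V n \<noteq> UNIV" for n
    unfolding M_def using V(2) that by (intro Max_ge) auto
  show ?thesis
  proof
    show "M \<ge> 0" unfolding M_def using V(2) by (intro Max_ge) auto
    fix y assume y: "y \<in> X" "\<And>n. \<bar>n\<bar> \<le> M \<Longrightarrow> y n = x n"
    have "y n \<in> V n" for n
    proof (cases "V n = UNIV")
      case False
      then show ?thesis using y(2)[OF M] V(1) by auto
    qed simp
    then have "y \<in> U" using V(3) by auto
    then show "f y i = f x i" using U(2) y(1) by blast
  qed
qed

section \<open>Admissible sets\<close>

lemma admissible_singleton_iff_missed_class:
  assumes "b \<ge> 2"
  shows "admissible {b} A \<longleftrightarrow> (\<exists>r\<in>{0..<int b}. \<forall>a\<in>A. a mod int b \<noteq> r)"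
  using admissible_iff_missed_class[of "{b}" A] assms by simp

lemma admissible_iff_singletons: "admissible B A \<longleftrightarrow> (\<forall>b\<in>B. admissible {b} A)"
  by (simp add: admissible_def)

lemma admissible_singleton_if_card_less:
  assumes "finite A" "card A < b"
  shows "admissible {b} A"
  using card_image_le[OF assms(1), of "\<lambda>a. a mod int b"] assms(2) by (simp add: admissible_def)

lemma spikyD:
  assumes "spiky B" "finite S" "S \<subseteq> B" "b \<in> B" "b dvd Lcm S"
  shows "b \<in> S"
  using assms unfolding spiky_def by blast

text \<open>
  Induction on \<open>S\<close>: suppose \<open>a\<close> satisfies all the conditions except perhaps the one at \<open>s\<close>.
  Adding the least common multiple \<open>L\<close> of the other moduli keeps these conditions, and as \<open>s\<close>
  does not divide \<open>L\<close>, the numbers \<open>a\<close> and \<open>a + L\<close> are in different classes modulo \<open>s\<close>. So one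
  of them avoids \<open>c s\<close>. Finally, adding a multiple of all moduli makes \<open>a\<close> as large as desired.
\<close>

lemma spiky_avoid_classes:
  fixes c :: "nat \<Rightarrow> int" and r M :: int
  assumes "spiky B" "finite S" "S \<subseteq> B" "finite T" "T \<subseteq> B" "S \<inter> T = {}"
  shows "\<exists>a > M. [a = r] (mod int (Lcm T)) \<and> (\<forall>s\<in>S. a mod int s \<noteq> c s)"
proof -
  have pos: "0 < Lcm F" if "finite F" "F \<subseteq> B" for F
  proof -
    have "B \<subseteq> {2..}" using assms(1) unfolding spiky_def by (rule conjunct1)
    then have "0 \<notin> F" using that(2) by auto
    then show ?thesis using Lcm_0_iff_nat[OF that(1)] by linarith
  qed
  have "\<exists>a. [a = r] (mod int (Lcm T)) \<and> (\<forall>s\<in>S. a mod int s \<noteq> c s)"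
    using assms(2,3,6)
  proof (induction S rule: finite_induct)
    case empty
    have "[r = r] (mod int (Lcm T))" by (rule cong_refl)
    then show ?case by blast
  next
    case (insert s S)
    then obtain a where a: "[a = r] (mod int (Lcm T))" "\<forall>s\<in>S. a mod int s \<noteq> c s"
      by blast
    define L where "L = Lcm (S \<union> T)"
    have "\<not> s dvd L"
    proof
      assume "s dvd L"
      have "s \<in> S \<union> T"
      proof (rule spikyD[OF assms(1)])
        show "finite (S \<union> T)" using assms(4) insert.hyps(1) by simp
        show "S \<union> T \<subseteq> B" "s \<in> B" using assms(5) insert.prems(1) by blast+
        show "s dvd Lcm (S \<union> T)" using \<open>s dvd L\<close> by (simp only: L_def)
      qed
      then show False using insert.hyps(2) insert.prems(2) by blast
    qed
    have "Lcm T dvd L" unfolding L_def by (rule Lcm_subset) simp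
    then have cong_L: "[a + int L = r] (mod int (Lcm T))"
      using cong_add[OF a(1), of "int L" 0] by (simp add: cong_0_iff)
    have "(a + int L) mod int t = a mod int t" if "t \<in> S" for t
    proof -
      have "t dvd L" unfolding L_def using that by (intro dvd_Lcm) simp
      then have "[a + int L = a + 0] (mod int t)" by (intro cong_add) (auto simp: cong_0_iff)
      then show ?thesis by (simp add: cong_def)
    qed
    moreover have "a mod int s \<noteq> c s \<or> (a + int L) mod int s \<noteq> c s"
    proof (rule ccontr)
      assume "\<not> ?thesis"
      then have "a mod int s = c s" "(a + int L) mod int s = c s" by blast+
      then have "(a + int L) mod int s = a mod int s" by (simp only:)
      then have "int s dvd (a + int L) - a" by (simp only: mod_eq_dvd_iff)
      then show False using \<open>\<not> s dvd L\<close> by simp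
    qed
    ultimately have "\<forall>t\<in>insert s S. (a + int L) mod int t \<noteq> c t" if "a mod int s = c s"
      using a(2) that by simp
    moreover have "\<forall>t\<in>insert s S. a mod int t \<noteq> c t" if "a mod int s \<noteq> c s"
      using a(2) that by simp
    ultimately show ?case
      using a(1) cong_L by blast
  qed
  then obtain a where a: "[a = r] (mod int (Lcm T))" "\<forall>s\<in>S. a mod int s \<noteq> c s"
    by blast
  define L where "L = int (Lcm (S \<union> T))"
  have "L > 0"
    unfolding L_def of_nat_0_less_iff using assms(2-5) by (intro pos) auto
  \<comment> \<open>As \<open>L \<ge> 1\<close>, the summand added to \<open>a\<close> is at least \<open>\<bar>M\<bar> + \<bar>a\<bar> + 1\<close>.\<close>
  define a' where "a' = a + (\<bar>M\<bar> + \<bar>a\<bar> + 1) * L"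
  have "M < a'"
  proof -
    have "\<bar>M\<bar> + \<bar>a\<bar> + 1 \<le> (\<bar>M\<bar> + \<bar>a\<bar> + 1) * L"
      using mult_left_mono[of 1 L "\<bar>M\<bar> + \<bar>a\<bar> + 1"] \<open>L > 0\<close> by simp
    then show ?thesis unfolding a'_def by linarith
  qed
  moreover have cong: "[a' = a] (mod m)" if "m dvd L" for m
  proof -
    have "a' - a = (\<bar>M\<bar> + \<bar>a\<bar> + 1) * L" by (simp add: a'_def)
    then show ?thesis using that by (metis cong_iff_dvd_diff dvd_mult)
  qed
  have "int (Lcm T) dvd L"
    unfolding L_def int_dvd_int_iff by (rule Lcm_subset) simp
  then have "[a' = r] (mod int (Lcm T))"
    by (rule cong_trans[OF cong a(1)])
  moreover have "a' mod int s \<noteq> c s" if "s \<in> S" for s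
  proof -
    have "int s dvd L"
      unfolding L_def int_dvd_int_iff using that by (intro dvd_Lcm) simp
    from cong[OF this] show ?thesis using a(2) that by (simp add: cong_def)
  qed
  ultimately show ?thesis by blast
qed

text \<open>
  The representatives are chosen one after the other, each more than \<open>K\<close> beyond its predecessor.
\<close>

lemma sparse_class_representatives:
  fixes c :: "nat \<Rightarrow> int" and M K :: int
  assumes "spiky B" "b \<in> B" "finite S" "S \<subseteq> B - {b}" "K \<ge> 0"
  obtains d :: "nat \<Rightarrow> int" where "\<And>r. d r > M" "\<And>r. d r mod int b = int r mod int b"
    "\<And>r s. s \<in> S \<Longrightarrow> d r mod int s \<noteq> c s" "\<And>i j. i \<noteq> j \<Longrightarrow> \<bar>d i - d j\<bar> > K"
proof -
  let ?P = "\<lambda>r a. a > M \<and> a mod int b = int r mod int b \<and> (\<forall>s\<in>S. a mod int s \<noteq> c s)"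
  have ex: "\<exists>a. ?P r a \<and> a > m" for r m
  proof -
    have "\<exists>a > max M m. [a = int r] (mod int (Lcm {b})) \<and> (\<forall>s\<in>S. a mod int s \<noteq> c s)"
      using assms by (intro spiky_avoid_classes) auto
    then show ?thesis by (auto simp: cong_def)
  qed
  obtain d where d: "\<And>r. ?P r (d r)" "\<And>r. d (Suc r) > d r + K"
  proof -
    have "\<exists>a. ?P 0 a" using ex by blast
    moreover have "\<exists>y. ?P (Suc n) y \<and> y > x + K" for x n using ex by blast
    ultimately have "\<exists>d. \<forall>n. ?P n (d n) \<and> d (Suc n) > d n + K"
      by (rule dependent_nat_choice)
    then show thesis using that by blast
  qed
  have gap: "d i + K < d j" if "i < j" for i j
    using that
  proof (induction rule: less_Suc_induct)
    case (1 i)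
    then show ?case by (rule d)
  next
    case (2 i j k)
    then show ?case using assms(5) by linarith
  qed
  have "\<bar>d i - d j\<bar> > K" if "i \<noteq> j" for i j
    using gap[of i j] gap[of j i] that by (cases i j rule: linorder_cases) auto
  then show ?thesis using d that by blast
qed

section \<open>Maps that do not increase the support\<close>

lemma point_mem_admissible_subshift:
  assumes "B \<subseteq> {2..}"
  shows "(\<lambda>n. n = k) \<in> admissible_subshift B"
  using assms by (auto simp: admissible_subshift_def admissible_def Collect_conv_if)

text \<open>
  If \<open>x 0\<close> fails, a window of \<open>x\<close> around \<open>0\<close> extends to an admissible point \<open>y\<close> that contains a
  representative of every nonzero class modulo some \<open>b \<in> B\<close>, and these representatives
  survive in \<open>f y\<close> together with \<open>0\<close>.
\<close>

lemma equivariant_image_at_0: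
  assumes "spiky B" "infinite B"
    and X: "X = admissible_subshift B"
    and cont: "continuous_on X f" and maps: "f ` X \<subseteq> X"
    and commute: "\<And>x. x \<in> X \<Longrightarrow> f (left_shift x) = left_shift (f x)"
    and point: "f (\<lambda>n. n = 0) 0"
    and x: "x \<in> X" and fx: "f x 0"
  shows "x 0"
proof (rule ccontr)
  assume "\<not> x 0"
  have B: "B \<subseteq> {2..}" using assms(1) by (simp add: spiky_def)
  have sub: "subshift X" unfolding X by (rule subshift_admissible_subshift[OF B])
  obtain M where "M \<ge> 0"
    and M: "\<And>y. y \<in> X \<Longrightarrow> (\<And>n. \<bar>n\<bar> \<le> M \<Longrightarrow> y n = x n) \<Longrightarrow> f y 0"
    using continuous_on_window[OF cont x, of 0] fx by metis
  have "(\<lambda>n. n = 0) \<in> X" unfolding X by (rule point_mem_admissible_subshift[OF B])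
  then obtain K where "K \<ge> 0"
    and K: "\<And>y. y \<in> X \<Longrightarrow> (\<And>n. \<bar>n\<bar> \<le> K \<Longrightarrow> y n = (n = 0)) \<Longrightarrow> f y 0"
    using continuous_on_window[OF cont, of "\<lambda>n. n = 0" 0] point by metis
  \<comment> \<open>Within the window, \<open>0\<close> is then the only multiple of \<open>b\<close>.\<close>
  obtain b where b: "b \<in> B" "nat M < b"
    using assms(2) by (meson infinite_nat_iff_unbounded)
  have b2: "b \<ge> 2" using b(1) B by auto
  define A where "A = {n. x n \<and> \<bar>n\<bar> \<le> M}"
  have "finite A"
    unfolding A_def by (rule finite_subset[of _ "{-M..M}"]) auto
  \<comment> \<open>The support of \<open>y\<close> will have fewer than \<open>card A + b\<close> points, too few to meet all classes modulo a
    larger element of \<open>B\<close>.\<close>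
  define S where "S = {s \<in> B. s \<noteq> b \<and> s \<le> card A + b}"
  have "\<exists>r\<in>{0..<int s}. \<forall>n\<in>{n. x n}. n mod int s \<noteq> r" if "s \<in> S" for s
    using x that B unfolding X S_def admissible_subshift_def admissible_iff_missed_class[OF B]
    by blast
  then obtain c where c: "\<And>s. s \<in> S \<Longrightarrow> c s \<in> {0..<int s}"
      "\<And>s n. s \<in> S \<Longrightarrow> x n \<Longrightarrow> n mod int s \<noteq> c s"
    by (metis mem_Collect_eq)
  have "finite S" "S \<subseteq> B - {b}"
    unfolding S_def by (auto intro: finite_subset[of _ "{..card A + b}"])
  then obtain d where d: "\<And>r. d r > M + K" "\<And>r. d r mod int b = int r mod int b"
    "\<And>r s. s \<in> S \<Longrightarrow> d r mod int s \<noteq> c s" "\<And>i j. i \<noteq> j \<Longrightarrow> \<bar>d i - d j\<bar> > K"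
    using sparse_class_representatives[OF assms(1) b(1) _ _ \<open>K \<ge> 0\<close>] by metis
  define D where "D = d ` {1..<b}"
  define y where "y = (\<lambda>n. n \<in> A \<union> D)"
  have "admissible {s} (A \<union> D)" if "s \<in> B" for s
  proof -
    have "s = b \<or> s \<in> S \<or> s > card A + b"
      using that by (auto simp: S_def)
    then consider "s = b" | "s \<in> S" | "s > card A + b"
      by blast
    then show ?thesis
    proof cases
      case 1
      have "n mod int b \<noteq> 0" if "n \<in> A" for n
      proof
        assume "n mod int b = 0"
        then have "int b dvd n" by (simp add: mod_0_imp_dvd)
        moreover have "n \<noteq> 0" "\<bar>n\<bar> \<le> M" using that \<open>\<not> x 0\<close> by (auto simp: A_def)
        ultimately show False using dvd_imp_le_int[of n "int b"] b(2) by simp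
      qed
      moreover have "n mod int b \<noteq> 0" if "n \<in> D" for n
      proof -
        obtain j where "n = d j" "1 \<le> j" "j < b" using \<open>n \<in> D\<close> by (auto simp: D_def)
        then show ?thesis using d(2)[of j] by simp
      qed
      moreover have "0 \<in> {0..<int b}" using b2 by simp
      ultimately show ?thesis
        unfolding 1 admissible_singleton_iff_missed_class[OF b2] by blast
    next
      case 2
      have "s \<ge> 2" using that B by auto
      then show ?thesis
        unfolding admissible_singleton_iff_missed_class[OF \<open>s \<ge> 2\<close>]
        using 2 c d(3) by (intro bexI[of _ "c s"]) (auto simp: A_def D_def)
    next
      case 3
      have "card D \<le> b" unfolding D_def using card_image_le[of "{1..<b}" d] by simp
      then have "card (A \<union> D) < s" using 3 card_Un_le[of A D] by linarith
      then show ?thesis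
        using \<open>finite A\<close> by (intro admissible_singleton_if_card_less) (auto simp: D_def)
    qed
  qed
  then have y: "y \<in> X"
    unfolding X admissible_subshift_def y_def mem_Collect_eq Collect_mem_eq
    using admissible_iff_singletons[of B "A \<union> D"] by blast
  \<comment> \<open>The points of \<open>D\<close> lie outside the window in which \<open>x\<close> determines whether \<open>f\<close> has a \<open>1\<close> at \<open>0\<close>.\<close>
  have f0: "f y 0"
  proof (rule M[OF y])
    fix n :: int assume "\<bar>n\<bar> \<le> M"
    moreover have "n \<noteq> d j" for j using d(1)[of j] \<open>\<bar>n\<bar> \<le> M\<close> \<open>K \<ge> 0\<close> by linarith
    then have "n \<notin> D" by (auto simp: D_def)
    ultimately show "y n = x n" by (simp add: y_def A_def)
  qed
  \<comment> \<open>Around a point of \<open>D\<close>, the sequence \<open>y\<close> is a translate of the sequence supported on \<open>{0}\<close>.\<close>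
  have fD: "f y (d r)" if "r \<in> {1..<b}" for r
  proof -
    have "f (left_shift_power (d r) y) 0"
    proof (rule K[OF left_shift_power_mem[OF sub y]])
      fix n :: int assume n: "\<bar>n\<bar> \<le> K"
      have "n + d r \<notin> A" using n d(1)[of r] by (auto simp: A_def)
      moreover have "n + d r \<in> D \<longleftrightarrow> n = 0"
      proof
        assume "n + d r \<in> D"
        then obtain j where "n + d r = d j" by (auto simp: D_def)
        then show "n = 0" using d(4)[of j r] n by (cases "j = r") auto
      qed (use that in \<open>simp add: D_def\<close>)
      ultimately show "left_shift_power (d r) y n = (n = 0)"
        by (simp add: left_shift_power_apply y_def)
    qed
    then show ?thesis
      by (simp add: commutes_left_shift_power[where f = f, OF sub commute y] left_shift_power_apply)
  qed
  have "f y \<in> X" using maps y by blast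
  then obtain r where r: "r \<in> {0..<int b}" "\<And>n. f y n \<Longrightarrow> n mod int b \<noteq> r"
    using b(1) unfolding X admissible_subshift_def admissible_iff_missed_class[OF B] by blast
  show False
  proof (cases "r = 0")
    case True
    then show False using r(2)[OF f0] by simp
  next
    case False
    then have "nat r \<in> {1..<b}" using r(1) by auto
    from r(2)[OF fD[OF this]] show False using d(2)[of "nat r"] r(1) by simp
  qed
qed

lemma equivariant_image_le:
  assumes "spiky B" "infinite B"
    and X: "X = admissible_subshift B"
    and "continuous_on X f" and "f ` X \<subseteq> X"
    and commute: "\<And>x. x \<in> X \<Longrightarrow> f (left_shift x) = left_shift (f x)"
    and "f (\<lambda>n. n = 0) 0"
    and x: "x \<in> X"
  shows "f x \<le> x"
proof (rule le_funI, rule le_boolI)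
  fix i assume "f x i"
  have sub: "subshift X"
    unfolding X using assms(1) by (intro subshift_admissible_subshift) (simp add: spiky_def)
  have "f (left_shift_power i x) 0"
    using \<open>f x i\<close>
    by (simp add: commutes_left_shift_power[where f = f, OF sub commute x] left_shift_power_apply)
  with assms(1-7) left_shift_power_mem[OF sub x] have "left_shift_power i x 0"
    by (rule equivariant_image_at_0[where f = f])
  then show "x i" by (simp add: left_shift_power_apply)
qed

section \<open>Automorphisms of the admissible subshift\<close>

text \<open>
  The zero point is fixed by the shift, so its image is a constant sequence, and the constant
  sequence of ones is not admissible once \<open>B\<close> is nonempty.
\<close>

lemma equivariant_image_zero:
  assumes "B \<subseteq> {2..}" "B \<noteq> {}"
    and X: "X = admissible_subshift B" and "f ` X \<subseteq> X"
    and commute: "\<And>x. x \<in> X \<Longrightarrow> f (left_shift x) = left_shift (f x)"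
  shows "f (\<lambda>n. False) = (\<lambda>n. False)" "(\<lambda>n. False) \<in> X"
proof -
  let ?z = "\<lambda>n :: int. False"
  have sub: "subshift X" unfolding X by (rule subshift_admissible_subshift[OF assms(1)])
  show z: "?z \<in> X"
    using assms(1) unfolding X by (auto simp: admissible_subshift_def admissible_def)
  have const: "f ?z k = f ?z 0" for k
  proof -
    have "left_shift_power k ?z = ?z" by (rule ext) (simp add: left_shift_power_apply)
    then have "f ?z = left_shift_power k (f ?z)"
      using commutes_left_shift_power[where f = f, OF sub commute z, of k] by simp
    then have "f ?z 0 = left_shift_power k (f ?z) 0" by simp
    then show ?thesis by (simp add: left_shift_power_apply)
  qed
  have "\<not> f ?z 0"
  proof
    assume "f ?z 0"
    then have "f ?z n" for n using const by blast
    moreover have "f ?z \<in> X" using assms(4) z by blast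
    moreover obtain b where "b \<in> B" using assms(2) by blast
    ultimately obtain r where "r \<in> {0..<int b}" "\<And>n. n mod int b \<noteq> r"
      unfolding X admissible_subshift_def admissible_iff_missed_class[OF assms(1)] by blast
    then show False by (metis atLeastLessThan_iff mod_pos_pos_trivial)
  qed
  then show "f ?z = ?z" using const by (intro ext) simp
qed

text \<open>
  With \<open>k\<close> in the support of the image of the sequence supported on \<open>{0}\<close>, the map \<open>h\<close> obtained by
  shifting \<open>f\<close> by \<open>k\<close> does not enlarge supports. Hence \<open>h\<close> fixes that sequence, so its inverse \<open>h'\<close>
  does not enlarge supports either, and \<open>h x \<le> x = h' (h x) \<le> h x\<close>.
\<close>

lemma Aut_admissible_subshift_is_shift:
  assumes "spiky B" "infinite B" and X: "X = admissible_subshift B" and f: "f \<in> Aut X"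
  shows "\<exists>k. f = restrict (left_shift_power k) X"
proof -
  have B: "B \<subseteq> {2..}" "B \<noteq> {}" using assms(1,2) by (auto simp: spiky_def)
  have sub: "subshift X" unfolding X by (rule subshift_admissible_subshift[OF B(1)])
  obtain g where hom: "homeomorphism X X f g"
    and commute: "\<And>x. x \<in> X \<Longrightarrow> f (left_shift x) = left_shift (f x)"
    and ext: "f \<in> extensional X"
    using f by (auto simp: Aut_def)
  note gf = homeomorphism_apply1[OF hom] and fg = homeomorphism_apply2[OF hom]
  have fX: "f ` X \<subseteq> X" and gX: "g ` X \<subseteq> X"
    using hom by (auto simp: homeomorphism_def)
  have gcommute: "g (left_shift x) = left_shift (g x)" if "x \<in> X" for x
  proof -
    have "g x \<in> X" using gX that by blast
    then have "left_shift (g x) \<in> X" using sub by (auto simp: subshift_def)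
    then have "g (f (left_shift (g x))) = left_shift (g x)" by (rule gf)
    then show ?thesis using commute[OF \<open>g x \<in> X\<close>] fg[OF that] by simp
  qed
  let ?e = "\<lambda>n :: int. n = 0"
  have e: "?e \<in> X" unfolding X by (rule point_mem_admissible_subshift[OF B(1)])
  note zero = equivariant_image_zero[OF B X fX commute]
  have "f ?e \<noteq> (\<lambda>n. False)"
    using gf[OF e] gf[OF zero(2)] zero(1) by (metis (full_types))
  then obtain k where k: "f ?e k" by fastforce
  define h where "h = (\<lambda>x. left_shift_power k (f x))"
  define h' where "h' = (\<lambda>x. g (left_shift_power (- k) x))"
  have mem: "left_shift_power j x \<in> X" if "x \<in> X" for j x
    by (rule left_shift_power_mem[OF sub that])
  have le: "h x \<le> x" if "x \<in> X" for x
  proof (rule equivariant_image_le[OF assms(1,2) X _ _ _ _ that])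
    show "continuous_on X h"
      unfolding h_def using hom
      by (auto intro!: continuous_on_compose2[OF continuous_on_left_shift_power[of UNIV]]
          simp: homeomorphism_def)
    show "h ` X \<subseteq> X" using fX mem by (auto simp: h_def)
    show "h (left_shift x) = left_shift (h x)" if "x \<in> X" for x
      using that by (simp add: h_def commute left_shift_power_commute)
    show "h ?e 0" using k by (simp add: h_def left_shift_power_apply)
  qed
  have h'h: "h' (h x) = x" if "x \<in> X" for x
    using that by (simp add: h_def h'_def left_shift_power_add left_shift_power_0 gf)
  have "h ?e = ?e"
    using le[OF e] k by (auto simp: le_fun_def h_def left_shift_power_apply fun_eq_iff)
  then have "h' ?e = ?e" using h'h[OF e] by simp
  have h'X: "h' ` X \<subseteq> X" using gX mem by (auto simp: h'_def)
  have le': "h' x \<le> x" if "x \<in> X" for x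
  proof (rule equivariant_image_le[OF assms(1,2) X _ h'X _ _ that])
    show "continuous_on X h'"
      unfolding h'_def using hom mem
      by (auto intro!: continuous_on_compose2[of X g] continuous_on_left_shift_power
          simp: homeomorphism_def)
    show "h' (left_shift x) = left_shift (h' x)" if "x \<in> X" for x
      using that mem by (simp add: h'_def gcommute left_shift_power_commute)
    show "h' ?e 0" by (simp add: \<open>h' ?e = ?e\<close>)
  qed
  have "h x = x" if "x \<in> X" for x
  proof (rule antisym[OF le[OF that]])
    have "h x \<in> X" using fX mem that by (auto simp: h_def)
    from le'[OF this] show "x \<le> h x" by (simp add: h'h that)
  qed
  then have "f x = left_shift_power (- k) x" if "x \<in> X" for x
    using that by (metis h_def left_shift_power_0 left_shift_power_add add.left_inverse)
  then have "f = restrict (left_shift_power (- k)) X"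
    using ext by (intro extensionalityI[of _ X]) auto
  then show ?thesis by blast
qed

theorem corollary4p1:
  fixes B :: "nat set"
  assumes "spiky B" and "infinite B"
  shows "Aut (admissible_subshift B) =
    {restrict (left_shift_power n) (admissible_subshift B) | n :: int. True}"
proof -
  have "subshift (admissible_subshift B)"
    using assms(1) by (intro subshift_admissible_subshift) (simp add: spiky_def)
  then show ?thesis
    using Aut_admissible_subshift_is_shift[OF assms refl] restrict_left_shift_power_in_Aut
    by blast
qed

end
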